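(* Fix a prime $p$ and positive integers $m\le n$ and $s$, and put $n'=n-m\ge0$. The maximum and minimum of $f(p,s,m,n',\cdot)$ over all integer vectors ${\boldsymbol b}=(b_1,\dots,b_s)$ with $m\ge b_1\ge\cdots\ge b_s\ge0$ are as follows. (i) If $p>2$, $s>1$ or $n'>0$, then $$\max_{\boldsymbol b}f(p,s,m,n',{\boldsymbol b})=\frac{[p,n'+m]}{[p,n']},$$ and the maximum is achieved if and only if ${\boldsymbol b}=(0,0,\dots,0)$, in other words, if the corresponding diagonal matrix $D$ is full rank. (ii) If $p=2$, $s=1$, $n'=0$ and $m>1$, then $$\max_{\boldsymbol b}f(p,s,m,n',{\boldsymbol b})=\frac{[2,m]^2}{[2,1][2,m-1]},$$ and the maximum is achieved if and only if ${\boldsymbol b}=(1)$. (iii) In both case (i) and case (ii), $$\min_{\boldsymbol b}f(p,s,m,n',{\boldsymbol b})=p^{-s(n'+m)m},$$ and the minimum is achieved if and only if ${\boldsymbol b}=(m,m,\dots,m)$, in other words, if the corresponding diagonal matrix $D$ is the zero matrix. (iv) If $p=2$, $s=1$, $n'=0$ and $m=1$, then ${\boldsymbol b}=(1)$ or $(0)$, and they have the same value of $f$, namely $1/2$.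
   Context: $[p,0]=1$ and $[p,\ell]=\prod_{j=1}^{\ell}(1-p^{-j})$ for positive integers $\ell$. With $b_0=m$, $$f(p,s,m,n',{\boldsymbol b})=p^{-\sum_{i=1}^{s}(n'+b_i)b_i}\cdot\frac{[p,n'+m][p,m]}{[p,n'+b_s][p,b_s]\prod_{i=1}^{s}[p,b_{i-1}-b_i]}.$$ The diagonal matrix $D$ corresponding to ${\boldsymbol b}$ is the $n\times m$ diagonal matrix over $\mathbb{Z}/p^s\mathbb{Z}$ with exactly $b_{i-1}-b_i$ diagonal entries equal to $p^{i-1}$ for $1\le i\le s$ and the remaining $b_s$ diagonal entries equal to $0$ (with each diagonal entry dividing the next); $f(p,s,m,n',{\boldsymbol b})$ is the probability that an $n\times m$ matrix with independent uniform entries in $\mathbb{Z}/p^s\mathbb{Z}$ has Smith normal form $D$ (up to multiplication of entries by units). Here "full rank" means that all diagonal entries of $D$ equal $1$.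
   Formalization: In (iii), the "only if" for the minimum is claimed except when p=2, n'=0, m=1 (with s>1): there b=(1,…,1,0) and b=(1,…,1) both give the minimum 2^{-s}, so uniqueness fails; the value and its attainment at (m,…,m) are still stated. *)

theory Defs
  imports
    "HOL-Analysis.Analysis"
    "HOL-Number_Theory.Residues"
    "Jordan_Normal_Form.Matrix"
begin

definition pbracket :: "nat \<Rightarrow> nat \<Rightarrow> real" where
  "pbracket p l = (\<Prod>j = 1..l. 1 - real p powi (- int j))"

(* A vector (b_1, ..., b_s) is a list b of length s. With the convention b_0 = m,
   the component b_i is (m # b) ! i for 0 <= i <= s. *)

definition bvecs :: "nat \<Rightarrow> nat \<Rightarrow> nat list set" where
  "bvecs s m = {b. length b = s \<and> sorted_wrt (\<ge>) (m # b)}"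

definition snf_density :: "nat \<Rightarrow> nat \<Rightarrow> nat \<Rightarrow> nat \<Rightarrow> nat list \<Rightarrow> real" where
  "snf_density p s m n' b =
     real p powi (- int (\<Sum>i = 1..s. (n' + (m # b) ! i) * (m # b) ! i)) *
     (pbracket p (n' + m) * pbracket p m /
      (pbracket p (n' + (m # b) ! s) * pbracket p ((m # b) ! s) *
       (\<Prod>i = 1..s. pbracket p ((m # b) ! (i - 1) - (m # b) ! i))))"

definition diag_entries :: "nat \<Rightarrow> nat \<Rightarrow> nat \<Rightarrow> nat list \<Rightarrow> int list" where
  "diag_entries p s m b =
     concat (map (\<lambda>i. replicate ((m # b) ! (i - 1) - (m # b) ! i) (int p ^ (i - 1))) [1..<s + 1])
     @ replicate ((m # b) ! s) 0"

(* Elements of Z/p^s are represented by their residues in {0..p^s - 1}, the carrier of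
   residue_ring (p^s). *)
definition corr_diag_mat :: "nat \<Rightarrow> nat \<Rightarrow> nat \<Rightarrow> nat \<Rightarrow> nat list \<Rightarrow> int mat" where
  "corr_diag_mat p s n m b =
     mat n m (\<lambda>(i, j). if i = j then diag_entries p s m b ! j else 0)"

(* For n x m matrices with m <= n. *)
definition full_rank_diag :: "int mat \<Rightarrow> bool" where
  "full_rank_diag D \<longleftrightarrow> (\<forall>j < dim_col D. D $$ (j, j) = 1)"

lemma length_diag_entries:
  assumes "b \<in> bvecs s m"
  shows "length (diag_entries p s m b) = m"
proof -
  have dec: "(m # b) ! Suc k \<le> (m # b) ! k" if "k < s" for k
    using assms that sorted_wrt_nth_less[of "(\<ge>)" "m # b" k "Suc k"] by (simp add: bvecs_def)
  have len: "length (diag_entries p k m b) = m" if "k \<le> s" for k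
    using that
  proof (induction k)
    case 0
    show ?case by (simp add: diag_entries_def)
  next
    case (Suc k)
    then show ?case using dec[of k] by (simp add: diag_entries_def)
  qed
  show ?thesis using len by simp
qed

lemma corr_diag_mat_carrier:
  assumes "p > 1" "s > 0" "b \<in> bvecs s m" "m \<le> n" "i < n" "j < m"
  shows "corr_diag_mat p s n m b $$ (i, j) \<in> carrier (residue_ring (int p ^ s))"
proof -
  have "x \<in> {0..int p ^ s - 1}" if "x \<in> set (diag_entries p s m b)" for x
  proof -
    have "int p ^ (k - 1) < int p ^ s" if "k \<in> {1..<s + 1}" for k
      using assms(1) that by (intro power_strict_increasing) auto
    then show ?thesis using that assms(1) by (auto simp: diag_entries_def split: if_splits)
  qed
  moreover have "diag_entries p s m b ! j \<in> set (diag_entries p s m b)"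
    using assms length_diag_entries[OF assms(3)] by (intro nth_mem) simp
  moreover have "0 \<in> {0..int p ^ s - 1}" using assms(1) by simp
  ultimately show ?thesis
    using assms by (simp add: corr_diag_mat_def residue_ring_def)
qed

(* For p = 2, n' = 0, m = 1 and s > 1 the minimizer of the density is not unique:
   over Z/4, the 1 x 1 matrices (0) and (2) both have probability 1/4. *)
lemma snf_density_min_not_unique:
  "snf_density 2 2 1 0 [1, 0] = 1 / 4"
  "snf_density 2 2 1 0 [1, 1] = 1 / 4"
  by (simp_all add: snf_density_def pbracket_def numeral_2_eq_2 power_int_minus)

end

theory Submission
  imports Defs
begin

text \<open>
  The density is a product of densities over the field with \<open>p\<close> elements. Put
  \<open>q = 1 / p\<close>, \<open>k = n'\<close> and
  \<open>g(a, c) = q^((k + c) c) [p, k + a] [p, a] / ([p, k + c] [p, c] [p, a - c])\<close>,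
  the probability that a uniform \<open>(k + a) \<times> a\<close> matrix over that field has corank \<open>c\<close>. In the
  product \<open>g(b\<^sub>0, b\<^sub>1) \<cdots> g(b\<^sub>s\<^sub>-\<^sub>1, b\<^sub>s)\<close> the brackets \<open>[p, k + b\<^sub>i] [p, b\<^sub>i]\<close> with
  \<open>0 < i < s\<close> cancel, and what is left is \<open>f\<close> (\<open>snf_density_eq_chain_prob\<close>).

  The proof rests on the monotonicity of \<open>g\<close> in the corank. The quotient
  \<open>g(a, c + 1) / g(a, c)\<close> equals
  \<open>q^(k + 2c + 1) (1 - q^(a - c)) / ((1 - q^(k + c + 1)) (1 - q^(c + 1)))\<close>,
  which is below \<open>1\<close> by crude estimates unless \<open>p = 2\<close>, \<open>k = 0\<close> and \<open>c = 0\<close>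
  (\<open>corank_prob_strict_antimono\<close>). In that one case it equals \<open>2 (1 - 2^(-a))\<close>: corank \<open>1\<close> beats
  corank \<open>0\<close> for square binary matrices of size at least \<open>2\<close>, and ties with it for size \<open>1\<close>.

  Maximum: all factors are at most \<open>1\<close>, so a chain is bounded by its first factor
  \<open>g(m, b\<^sub>1)\<close>, and the chain of zeros attains \<open>g(m, 0)\<close>. Monotonicity finishes the proof except
  for square binary matrices. There, with \<open>b\<^sub>1 \<ge> 2\<close>, one still has \<open>g(m, b\<^sub>1) < g(m, 0)\<close>; with
  \<open>b\<^sub>1 = 1\<close> and \<open>s > 1\<close>, the gain \<open>2 (1 - 2^(-m)) < 2\<close> is undone by the second factor
  \<open>g(1, b\<^sub>2) = 1 / 2\<close>; with \<open>s = 1\<close> the corank \<open>1\<close> wins.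

  Minimum: every factor satisfies \<open>g(a, c) \<ge> g(a, a) = q^((k + a) a) \<ge> q^((k + m) m)\<close>
  when \<open>c \<le> a \<le> m\<close>. The first inequality is strict for \<open>c < a\<close>, except for \<open>1 \<times> 1\<close> binary matrices;
  applied at the first index where the chain drops below \<open>m\<close>, it gives uniqueness.
\<close>

section \<open>The bracket\<close>

lemma powi_neg_eq: "real p powi (- int k) = (1 / real p) ^ k"
  by (simp add: power_int_minus power_one_over inverse_eq_divide)

lemma pbracket_0 [simp]: "pbracket p 0 = 1"
  by (simp add: pbracket_def)

lemma pbracket_Suc: "pbracket p (Suc l) = pbracket p l * (1 - (1 / real p) ^ Suc l)"
  unfolding pbracket_def powi_neg_eq by (simp add: mult.commute)

lemma recip_bounds:
  assumes "2 \<le> p"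
  shows "0 < 1 / real p" "1 / real p \<le> 1 / 2" "1 / real p < 1"
  using assms by (auto simp: field_simps)

lemma recip_power_bounds:
  assumes "2 \<le> p"
  shows "0 < (1 / real p) ^ j" "0 < j \<Longrightarrow> (1 / real p) ^ j < 1"
  using recip_bounds[OF assms] by (simp, simp add: power_Suc_less_one power_less_one_iff)

lemma pbracket_pos:
  assumes "2 \<le> p"
  shows "0 < pbracket p l"
proof (induction l)
  case (Suc l)
  then show ?case
    using recip_power_bounds(2)[OF assms, of "Suc l"] unfolding pbracket_Suc by simp
qed simp

lemma pbracket_add_le:
  assumes "2 \<le> p"
  shows "pbracket p (k + a) \<le> pbracket p k"
proof (induction a)
  case (Suc a)
  have "pbracket p (k + a) * (1 - (1 / real p) ^ Suc (k + a)) \<le> pbracket p (k + a) * 1"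
    using pbracket_pos[OF assms, of "k + a"] recip_power_bounds(1)[OF assms, of "Suc (k + a)"]
    by (intro mult_left_mono) auto
  with Suc show ?case by (simp add: pbracket_Suc)
qed simp

text \<open>Each factor of the bracket is at least \<open>1 / p\<close> since \<open>p \<ge> 2\<close>. The bound is used to compare
  nonsingular with zero matrices where the probability is not monotone in the corank.\<close>

lemma pbracket_ge_power:
  assumes "2 \<le> p"
  shows "(1 / real p) ^ l \<le> pbracket p l"
proof (induction l)
  case (Suc l)
  have "(1 / real p) ^ Suc l \<le> (1 / real p) ^ 1"
    using recip_bounds[OF assms] by (intro power_decreasing) auto
  then have "1 / real p \<le> 1 - (1 / real p) ^ Suc l"
    using recip_bounds(2)[OF assms] by simp
  then have "(1 / real p) ^ l * (1 / real p) \<le> pbracket p l * (1 - (1 / real p) ^ Suc l)"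
    using Suc recip_bounds[OF assms] pbracket_pos[OF assms, of l] by (intro mult_mono) auto
  then show ?case by (simp add: pbracket_Suc mult.commute)
qed simp

section \<open>Coranks over the field with p elements\<close>

text \<open>For \<open>c \<le> a\<close> and prime \<open>p\<close>, this is the probability that a uniformly random
  \<open>(k + a) \<times> a\<close> matrix over the field with \<open>p\<close> elements has corank \<open>c\<close>.\<close>

definition corank_prob :: "nat \<Rightarrow> nat \<Rightarrow> nat \<Rightarrow> nat \<Rightarrow> real" where
  "corank_prob p k a c =
     (1 / real p) ^ ((k + c) * c) * (pbracket p (k + a) * pbracket p a /
       (pbracket p (k + c) * pbracket p c * pbracket p (a - c)))"

lemma corank_prob_pos:
  assumes "2 \<le> p"
  shows "0 < corank_prob p k a c"
  unfolding corank_prob_def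
  using pbracket_pos[OF assms] recip_power_bounds(1)[OF assms] by simp

lemma corank_prob_0:
  assumes "2 \<le> p"
  shows "corank_prob p k a 0 = pbracket p (k + a) / pbracket p k"
  using pbracket_pos[OF assms, of a] by (simp add: corank_prob_def)

lemma corank_prob_self:
  assumes "2 \<le> p"
  shows "corank_prob p k a a = (1 / real p) ^ ((k + a) * a)"
  using pbracket_pos[OF assms, of a] pbracket_pos[OF assms, of "k + a"]
  by (simp add: corank_prob_def)

lemma corank_prob_0_le_1:
  assumes "2 \<le> p"
  shows "corank_prob p k a 0 \<le> 1"
  using pbracket_add_le[OF assms, of k a] pbracket_pos[OF assms, of k]
  by (simp add: corank_prob_0[OF assms])

text \<open>Consecutive coranks have a simple ratio because \<open>(k + c + 1) (c + 1) = (k + c) c + (k + 2c + 1)\<close>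
  and each bracket changes by one factor. The identity is kept free of division.\<close>

lemma corank_prob_Suc:
  assumes "2 \<le> p" "c < a"
  shows "corank_prob p k a (Suc c) * ((1 - (1 / real p) ^ (k + c + 1)) * (1 - (1 / real p) ^ (c + 1)))
       = corank_prob p k a c * ((1 / real p) ^ (k + 2 * c + 1) * (1 - (1 / real p) ^ (a - c)))"
proof -
  define q where "q = 1 / real p"
  obtain d where d: "a = c + Suc d" using assms(2) less_imp_Suc_add by auto
  have e: "(k + Suc c) * Suc c = (k + c) * c + (k + 2 * c + 1)" by (simp add: algebra_simps)
  have ne: "1 - q ^ Suc l \<noteq> 0" for l
    using recip_power_bounds(2)[OF assms(1), of "Suc l"] by (simp add: q_def del: power_Suc)
  have nz: "pbracket p l \<noteq> 0" for l using pbracket_pos[OF assms(1), of l] by simp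
  have ad: "a - c = Suc d" "a - Suc c = d" using d by auto
  define A B C U V W where "A = pbracket p (k + c)" "B = pbracket p c" "C = pbracket p d"
    "U = 1 - q ^ Suc (k + c)" "V = 1 - q ^ Suc c" "W = 1 - q ^ Suc d"
  note defs = this
  have nz': "A \<noteq> 0" "B \<noteq> 0" "C \<noteq> 0" "U \<noteq> 0" "V \<noteq> 0" "W \<noteq> 0"
    unfolding defs using ne nz by blast+
  have br: "pbracket p (k + Suc c) = A * U" "pbracket p (Suc c) = B * V" "pbracket p (Suc d) = C * W"
    unfolding defs q_def by (simp_all add: pbracket_Suc del: power_Suc)
  have x: "k + c + 1 = Suc (k + c)" "c + 1 = Suc c" by auto
  show ?thesis
    unfolding corank_prob_def ad br e x power_add[of _ "(k + c) * c"]
    unfolding q_def[symmetric] defs(4-6)[symmetric] defs(1-3)[symmetric]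
    using nz' by (simp add: field_simps)
qed

text \<open>Dropping the factor \<open>1 - q^(a - c)\<close> with \<open>q = 1 / p\<close>, the claim follows from
  \<open>1/3 \<le> 2/3 \<cdot> 2/3\<close> if \<open>p > 2\<close>, from \<open>1/4 \<le> 3/4 \<cdot> 1/2\<close> if \<open>k > 0\<close>, and from
  \<open>1/8 \<le> 3/4 \<cdot> 3/4\<close> if \<open>c > 0\<close>. For \<open>p = 2\<close> and \<open>k = c = 0\<close> it would read
  \<open>1/2 (1 - 2^(-a)) < 1/4\<close>, which is false for all \<open>a \<ge> 1\<close>.\<close>

lemma corank_step_inequality:
  assumes "2 \<le> p" "c < a" "p > 2 \<or> k > 0 \<or> c > 0"
  shows "(1 / real p) ^ (k + 2 * c + 1) * (1 - (1 / real p) ^ (a - c))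
       < (1 - (1 / real p) ^ (k + c + 1)) * (1 - (1 / real p) ^ (c + 1))"
proof -
  define q where "q = 1 / real p"
  have q: "0 < q" "q \<le> 1 / 2" using recip_bounds[OF assms(1)] by (auto simp: q_def)
  have dec: "q ^ j \<le> q ^ i" if "i \<le> j" for i j
    using that q by (intro power_decreasing) auto
  have q2: "q ^ 2 \<le> 1 / 4" using power_mono[OF q(2), of 2] q by (simp add: power2_eq_square)
  have q3: "q ^ 3 \<le> 1 / 8" using power_mono[OF q(2), of 3] q by (simp add: power3_eq_cube)
  have "q ^ (k + 2 * c + 1) * (1 - q ^ (a - c)) < q ^ (k + 2 * c + 1)"
    using q by simp
  also have "\<dots> \<le> (1 - q ^ (k + c + 1)) * (1 - q ^ (c + 1))"
  proof -
    have key: "q ^ (k + 2 * c + 1) \<le> (1 - q ^ (k + c + 1)) * (1 - q ^ (c + 1))"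
      if "q ^ (k + c + 1) \<le> x" "q ^ (c + 1) \<le> y" "q ^ (k + 2 * c + 1) \<le> (1 - x) * (1 - y)"
        "x \<le> 1" "y \<le> 1" for x y
      using mult_mono[of "1 - x" "1 - q ^ (k + c + 1)" "1 - y" "1 - q ^ (c + 1)"] that by linarith
    consider "p > 2" | "k > 0" | "c > 0" using assms(3) by blast
    then show ?thesis
    proof cases
      case 1
      then have "q \<le> 1 / 3" by (simp add: q_def field_simps)
      then show ?thesis
        using dec[of 1 "k + c + 1"] dec[of 1 "c + 1"] dec[of 1 "k + 2 * c + 1"]
        by (intro key[of "1 / 3" "1 / 3"]) auto
    next
      case 2
      have "q ^ (c + 1) \<le> q" using dec[of 1 "c + 1"] unfolding power_one_right by simp
      then have "q ^ (c + 1) \<le> 1 / 2" using q(2) by (rule order.trans)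
      with 2 show ?thesis
        using dec[of 2 "k + c + 1"] dec[of 2 "k + 2 * c + 1"] q q2
        by (intro key[of "1 / 4" "1 / 2"]) auto
    next
      case 3
      then show ?thesis
        using dec[of 2 "k + c + 1"] dec[of 2 "c + 1"] dec[of 3 "k + 2 * c + 1"] q2 q3
        by (intro key[of "1 / 4" "1 / 4"]) auto
    qed
  qed
  finally show ?thesis by (simp add: q_def)
qed

lemma corank_prob_Suc_less:
  assumes "2 \<le> p" "c < a" "p > 2 \<or> k > 0 \<or> c > 0"
  shows "corank_prob p k a (Suc c) < corank_prob p k a c"
proof -
  let ?R = "(1 - (1 / real p) ^ (k + c + 1)) * (1 - (1 / real p) ^ (c + 1))"
  have R: "0 < ?R"
    using recip_power_bounds(2)[OF assms(1), of "k + c + 1"]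
      recip_power_bounds(2)[OF assms(1), of "c + 1"] by (intro mult_pos_pos) auto
  have "corank_prob p k a (Suc c) * ?R < corank_prob p k a c * ?R"
    unfolding corank_prob_Suc[OF assms(1,2)]
    using corank_step_inequality[OF assms] corank_prob_pos[OF assms(1)]
    by (intro mult_strict_left_mono)
  then show ?thesis using mult_less_cancel_right_pos[OF R] by blast
qed

lemma corank_prob_strict_antimono:
  assumes "2 \<le> p" "c < d" "d \<le> a" "p > 2 \<or> k > 0 \<or> c > 0"
  shows "corank_prob p k a d < corank_prob p k a c"
  using assms(2,3)
proof (induction d)
  case (Suc d)
  have step: "corank_prob p k a (Suc d) < corank_prob p k a d"
    using Suc.prems assms(4) by (intro corank_prob_Suc_less[OF assms(1)]) auto
  show ?case
  proof (cases "c = d")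
    case False
    then have "corank_prob p k a d < corank_prob p k a c" using Suc by auto
    with step show ?thesis by simp
  qed (use step in simp)
qed simp

subsection \<open>Square matrices over the field with two elements\<close>

lemma corank_prob_square_2_1:
  assumes "0 < a"
  shows "corank_prob 2 0 a 1 = 2 * (1 - (1 / 2) ^ a) * corank_prob 2 0 a 0"
  using corank_prob_Suc[of 2 0 a 0] assms by simp

text \<open>The largest value is at corank \<open>1\<close>, where it is \<open>2 (1 - 2^(-a)) [2, a]\<close>; it does not exceed
  \<open>1\<close> because \<open>[2, a] \<le> [2, 1] = 1/2\<close> for \<open>a \<ge> 1\<close>.\<close>

lemma corank_prob_square_2_le_1:
  assumes "c \<le> a"
  shows "corank_prob 2 0 a c \<le> 1"
proof (cases "c = 0")
  case True
  then show ?thesis using corank_prob_0_le_1[of 2 0 a] by simp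
next
  case False
  then obtain d where d: "a = 1 + d" using assms by (cases a) auto
  have "corank_prob 2 0 a c \<le> corank_prob 2 0 a 1"
    using corank_prob_strict_antimono[of 2 1 c a 0] False assms by (cases "c = 1") auto
  also have "\<dots> = (1 - (1 / 2) ^ a) * (2 * pbracket 2 a)"
    using corank_prob_square_2_1[of a] d by (simp add: corank_prob_0)
  also have "\<dots> \<le> 1 * 1"
    using pbracket_add_le[of 2 1 d] pbracket_pos[of 2 a]
    by (intro mult_mono) (auto simp: d pbracket_Suc)
  finally show ?thesis by simp
qed

text \<open>The step from corank \<open>0\<close> to \<open>1\<close> gains a factor below \<open>2\<close>, and the step from \<open>1\<close> to \<open>2\<close>
  loses a factor \<open>1/8 (1 - 2^(1 - a)) / (9/16) < 2/9\<close>, more than enough to compensate.\<close>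

lemma corank_prob_square_2_ge_2_less:
  assumes "2 \<le> c" "c \<le> a"
  shows "corank_prob 2 0 a c < corank_prob 2 0 a 0"
proof -
  have "corank_prob 2 0 a c \<le> corank_prob 2 0 a 2"
    using corank_prob_strict_antimono[of 2 2 c a 0] assms by (cases "c = 2") auto
  also have "\<dots> < corank_prob 2 0 a 1 / 2"
  proof -
    have "corank_prob 2 0 a 2 * (9 / 16) = corank_prob 2 0 a 1 * (1 / 8 * (1 - (1 / 2) ^ (a - 1)))"
      using corank_prob_Suc[of 2 1 a 0] assms by (simp add: numeral_2_eq_2 power3_eq_cube)
    also have "\<dots> < corank_prob 2 0 a 1 * (9 / 32)"
    proof (intro mult_strict_left_mono)
      have bound: "1 / 8 * (1 - t) < 9 / 32" if "0 < t" for t :: real using that by simp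
      show "1 / 8 * (1 - (1 / 2) ^ (a - 1)) < 9 / (32 :: real)"
        by (rule bound, rule zero_less_power) simp
    qed (rule corank_prob_pos, simp)
    finally show ?thesis by simp
  qed
  also have "\<dots> \<le> corank_prob 2 0 a 0"
    using corank_prob_square_2_1[of a] assms corank_prob_pos[of 2 0 a 0] by simp
  finally show ?thesis .
qed

lemma corank_prob_square_2_max:
  assumes "2 \<le> a" "c \<le> a" "c \<noteq> 1"
  shows "corank_prob 2 0 a c < corank_prob 2 0 a 1"
proof (cases "c = 0")
  case True
  have "(1 / 2) ^ a \<le> (1 / 2 :: real) ^ 2" using assms(1) by (intro power_decreasing) auto
  then have "1 < 2 * (1 - (1 / 2 :: real) ^ a)" by (simp add: power2_eq_square)
  then show ?thesis
    using mult_strict_right_mono[OF _ corank_prob_pos[of 2 0 a 0], of 1] True assms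
      corank_prob_square_2_1[of a] by simp
next
  case False
  then show ?thesis using corank_prob_strict_antimono[of 2 1 c a 0] assms by simp
qed

subsection \<open>Bounds for all coranks\<close>

lemma corank_prob_le_1:
  assumes "2 \<le> p" "c \<le> a"
  shows "corank_prob p k a c \<le> 1"
proof (cases "p > 2 \<or> k > 0")
  case True
  then have "corank_prob p k a c \<le> corank_prob p k a 0"
    using corank_prob_strict_antimono[of p 0 c a k] assms by (cases "c = 0") auto
  then show ?thesis using corank_prob_0_le_1[OF assms(1), of k a] by simp
next
  case False
  then have "p = 2" "k = 0" using assms by auto
  then show ?thesis using corank_prob_square_2_le_1 assms by simp
qed

text \<open>The left-hand side is the probability of the zero matrix, that is, of corank \<open>a\<close>. Where
  monotonicity is not available, namely at corank \<open>0\<close> for square binary matrices, the comparison is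
  \<open>2^(-a\<^sup>2) < 2^(-a) \<le> [2, a]\<close>, which needs \<open>a \<ge> 2\<close>; for \<open>a = 1\<close> both coranks have probability \<open>1/2\<close>.\<close>

lemma corank_prob_gt_zero_matrix:
  assumes "2 \<le> p" "c < a" "\<not> (p = 2 \<and> k = 0 \<and> a = 1)"
  shows "(1 / real p) ^ ((k + a) * a) < corank_prob p k a c"
proof (cases "p > 2 \<or> k > 0 \<or> c > 0")
  case True
  then show ?thesis
    using corank_prob_strict_antimono[of p c a a k] assms by (simp add: corank_prob_self)
next
  case False
  then have eq: "p = 2" "k = 0" "c = 0" using assms by auto
  then have a: "2 \<le> a" using assms by auto
  have "(1 / real p) ^ (a * a) < (1 / real p) ^ a"
    using a recip_bounds[OF assms(1)] by (intro power_strict_decreasing) auto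
  also have "\<dots> \<le> pbracket p a" by (rule pbracket_ge_power[OF assms(1)])
  finally show ?thesis using eq by (simp add: corank_prob_0)
qed

lemma corank_prob_ge_zero_matrix:
  assumes "2 \<le> p" "c \<le> a"
  shows "(1 / real p) ^ ((k + a) * a) \<le> corank_prob p k a c"
proof (cases "c = a \<or> (p = 2 \<and> k = 0 \<and> a = 1)")
  case True
  have "corank_prob 2 0 1 0 = 1 / 2" by (simp add: corank_prob_0 pbracket_Suc)
  moreover have "c = a \<or> c = 0" using True assms(2) by auto
  ultimately show ?thesis using True assms(1)
    by (cases "c = a") (auto simp: corank_prob_self)
next
  case False
  then show ?thesis using corank_prob_gt_zero_matrix[OF assms(1), of c a k] assms by auto
qed

section \<open>The density as a chain of coranks\<close>

fun chain_prob :: "nat \<Rightarrow> nat \<Rightarrow> nat \<Rightarrow> nat list \<Rightarrow> real" where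
  "chain_prob p k a [] = 1"
| "chain_prob p k a (c # b) = corank_prob p k a c * chain_prob p k c b"

text \<open>Splitting off \<open>b\<^sub>1\<close> leaves the density for \<open>b\<^sub>1\<close> in place of \<open>m\<close>: the brackets
  \<open>[p, k + b\<^sub>1] [p, b\<^sub>1]\<close> in the denominator of the first factor cancel against those in the numerator
  of the second.\<close>

lemma snf_density_Cons:
  assumes "2 \<le> p"
  shows "snf_density p (Suc (length b)) a k (c # b) =
    corank_prob p k a c * snf_density p (length b) c k b"
proof -
  let ?s = "length b"
  have S: "(\<Sum>i = 1..Suc ?s. (k + (a # c # b) ! i) * (a # c # b) ! i) =
      (k + c) * c + (\<Sum>i = 1..?s. (k + (c # b) ! i) * (c # b) ! i)"
  proof -
    have "(\<Sum>i = 1..Suc ?s. (k + (a # c # b) ! i) * (a # c # b) ! i) =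
      (\<Sum>i = 0..?s. (k + (c # b) ! i) * (c # b) ! i)"
      using sum.shift_bounds_cl_Suc_ivl[of "\<lambda>i. (k + (a # c # b) ! i) * (a # c # b) ! i" 0 ?s]
      by simp
    then show ?thesis by (simp add: sum.atLeast_Suc_atMost)
  qed
  have P: "(\<Prod>i = 1..Suc ?s. pbracket p ((a # c # b) ! (i - 1) - (a # c # b) ! i)) =
      pbracket p (a - c) * (\<Prod>i = 1..?s. pbracket p ((c # b) ! (i - 1) - (c # b) ! i))"
  proof -
    have "(\<Prod>i = 1..Suc ?s. pbracket p ((a # c # b) ! (i - 1) - (a # c # b) ! i)) =
      (\<Prod>i = 0..?s. pbracket p ((a # c # b) ! i - (c # b) ! i))"
      using prod.shift_bounds_cl_Suc_ivl[of
          "\<lambda>i. pbracket p ((a # c # b) ! (i - 1) - (a # c # b) ! i)" 0 ?s]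
      by simp
    also have "\<dots> = pbracket p (a - c) * (\<Prod>i = 1..?s. pbracket p ((a # c # b) ! i - (c # b) ! i))"
      by (simp add: prod.atLeast_Suc_atMost)
    also have "(\<Prod>i = 1..?s. pbracket p ((a # c # b) ! i - (c # b) ! i)) =
        (\<Prod>i = 1..?s. pbracket p ((c # b) ! (i - 1) - (c # b) ! i))"
      by (intro prod.cong) (auto simp: nth_Cons')
    finally show ?thesis .
  qed
  have last: "(a # c # b) ! Suc ?s = (c # b) ! ?s" by simp
  have nz: "pbracket p l \<noteq> 0" for l using pbracket_pos[OF assms, of l] by simp
  have nzP: "(\<Prod>i = 1..?s. pbracket p ((c # b) ! (i - 1) - (c # b) ! i)) \<noteq> 0"
    using nz by simp
  show ?thesis
    unfolding snf_density_def S P last powi_neg_eq power_add corank_prob_def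
    using nz nzP by (simp add: field_simps)
qed

lemma snf_density_eq_chain_prob:
  assumes "2 \<le> p"
  shows "snf_density p (length b) a k b = chain_prob p k a b"
proof (induction b arbitrary: a)
  case Nil
  show ?case using pbracket_pos[OF assms, of a] pbracket_pos[OF assms, of "k + a"]
    by (simp add: snf_density_def)
next
  case (Cons c b)
  then show ?case using snf_density_Cons[OF assms] by simp
qed

lemma chain_prob_pos:
  assumes "2 \<le> p"
  shows "0 < chain_prob p k a b"
  by (induction b arbitrary: a) (auto simp: corank_prob_pos[OF assms])

lemma chain_prob_le_1:
  assumes "2 \<le> p" "sorted_wrt (\<ge>) (a # b)"
  shows "chain_prob p k a b \<le> 1"
  using assms(2)
proof (induction b arbitrary: a)
  case (Cons c b)
  have "corank_prob p k a c * chain_prob p k c b \<le> 1 * 1"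
    using Cons corank_prob_le_1[OF assms(1)] corank_prob_pos[OF assms(1), of k a c]
      chain_prob_pos[OF assms(1), of k c b]
    by (intro mult_mono) (auto simp: less_imp_le)
  then show ?case by simp
qed simp

lemma chain_prob_Cons_le:
  assumes "2 \<le> p" "sorted_wrt (\<ge>) (c # b)"
  shows "chain_prob p k a (c # b) \<le> corank_prob p k a c"
  using chain_prob_le_1[OF assms, of k] corank_prob_pos[OF assms(1), of k a c]
  by simp

lemma chain_prob_0:
  assumes "2 \<le> p"
  shows "chain_prob p k 0 (replicate t 0) = 1"
  by (induction t) (auto simp: corank_prob_self[OF assms])

lemma chain_prob_replicate_0:
  assumes "2 \<le> p" "0 < s"
  shows "chain_prob p k a (replicate s 0) = pbracket p (k + a) / pbracket p k"
  using assms by (cases s) (auto simp: chain_prob_0 corank_prob_0)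

lemma decreasing_from_0:
  assumes "sorted_wrt (\<ge>) ((0::nat) # b)"
  shows "b = replicate (length b) 0"
  using assms by (intro replicate_eqI) auto

text \<open>The hypothesis \<open>b \<noteq> 0\<close> forces \<open>b\<^sub>1 > 0\<close> because the vector decreases. The first factor
  alone decides, except for square binary matrices with \<open>b\<^sub>1 = 1\<close>; there \<open>s > 1\<close> supplies a second
  factor \<open>1/2\<close>, and \<open>2 (1 - 2^(-a)) \<cdot> 1/2 < 1\<close>.\<close>

lemma chain_prob_less_max:
  assumes p: "2 \<le> p" and dec: "sorted_wrt (\<ge>) (a # b)"
    and case_i: "p > 2 \<or> length b > 1 \<or> k > 0"
    and ne: "b \<noteq> replicate (length b) 0"
  shows "chain_prob p k a b < pbracket p (k + a) / pbracket p k"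
proof -
  obtain c d where b: "b = c # d" using ne by (cases b) auto
  have c: "0 < c" "c \<le> a" and dec': "sorted_wrt (\<ge>) (c # d)"
    using dec ne decreasing_from_0[of d] by (auto simp: b intro: ccontr)
  have "chain_prob p k a b < corank_prob p k a 0"
  proof (cases "(p > 2 \<or> k > 0) \<or> 2 \<le> c")
    case True
    have "chain_prob p k a b \<le> corank_prob p k a c"
      unfolding b by (rule chain_prob_Cons_le[OF p dec'])
    also have "\<dots> < corank_prob p k a 0"
    proof (cases "p > 2 \<or> k > 0")
      case True
      then show ?thesis using corank_prob_strict_antimono[of p 0 c a k] p c by auto
    next
      case False
      then have "p = 2" "k = 0" "2 \<le> c" using True p by auto
      then show ?thesis using corank_prob_square_2_ge_2_less c by simp
    qed
    finally show ?thesis .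
  next
    case False
    then have eq: "p = 2" "k = 0" "c = 1" using p c by auto
    obtain x e where d: "d = x # e" using case_i eq b by (cases d) auto
    have x: "x = 0 \<or> x = 1" using dec' eq d by auto
    have half: "corank_prob 2 0 1 x = 1 / 2"
      using x corank_prob_0[of 2 0 1] corank_prob_self[of 2 0 1] by (auto simp: pbracket_Suc)
    have "chain_prob 2 0 1 d \<le> 1 / 2"
      using chain_prob_Cons_le[of 2 x e 0 1] dec' unfolding d half by simp
    then have "chain_prob p k a b \<le> corank_prob 2 0 a 1 * (1 / 2)"
      unfolding b eq chain_prob.simps using corank_prob_pos[of 2 0 a 1]
      by (intro mult_left_mono) auto
    also have "\<dots> = (1 - (1 / 2) ^ a) * corank_prob 2 0 a 0"
      using c by (subst corank_prob_square_2_1) auto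
    also have "\<dots> < 1 * corank_prob 2 0 a 0"
      using corank_prob_pos[of 2 0 a 0] by (intro mult_strict_right_mono) auto
    finally show ?thesis by (simp add: eq)
  qed
  then show ?thesis by (simp add: corank_prob_0[OF p])
qed

lemma chain_prob_replicate_self:
  assumes "2 \<le> p"
  shows "chain_prob p k a (replicate t a) = (1 / real p) ^ (t * ((k + a) * a))"
  by (induction t) (auto simp: corank_prob_self[OF assms] power_add)

text \<open>The bound \<open>m\<close> on the start is separate from the start \<open>a\<close> itself, so that the induction can move
  to a smaller start while the bound on each factor stays the same.\<close>

lemma chain_prob_ge_min:
  assumes p: "2 \<le> p" and "sorted_wrt (\<ge>) (a # b)" "a \<le> m"
  shows "(1 / real p) ^ (length b * ((k + m) * m)) \<le> chain_prob p k a b"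
  using assms(2,3)
proof (induction b arbitrary: a)
  case (Cons c b)
  have "(1 / real p) ^ ((k + m) * m) \<le> (1 / real p) ^ ((k + a) * a)"
    using Cons.prems recip_bounds[OF p] by (intro power_decreasing mult_le_mono) auto
  also have "\<dots> \<le> corank_prob p k a c"
    using Cons.prems by (intro corank_prob_ge_zero_matrix[OF p]) auto
  finally have "(1 / real p) ^ ((k + m) * m) * (1 / real p) ^ (length b * ((k + m) * m))
      \<le> corank_prob p k a c * chain_prob p k c b"
    using Cons corank_prob_pos[OF p, of k a c] recip_bounds[OF p] by (intro mult_mono) auto
  then show ?case by (simp add: power_add)
qed simp

text \<open>As long as the chain stays at \<open>m\<close>, both sides acquire the same factor. Its first drop starts from
  \<open>m\<close>, so strictness depends on the shape \<open>(k + m) \<times> m\<close> only, although later drops may start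
  from \<open>1\<close>.\<close>

lemma chain_prob_gt_min:
  assumes p: "2 \<le> p" and "sorted_wrt (\<ge>) (m # b)" "b \<noteq> replicate (length b) m"
    and nexc: "\<not> (p = 2 \<and> k = 0 \<and> m = 1)"
  shows "(1 / real p) ^ (length b * ((k + m) * m)) < chain_prob p k m b"
  using assms(2,3)
proof (induction b)
  case (Cons c b)
  let ?z = "(1 / real p) ^ ((k + m) * m)"
  have "?z * (1 / real p) ^ (length b * ((k + m) * m)) < corank_prob p k m c * chain_prob p k c b"
  proof (cases "c = m")
    case True
    with Cons show ?thesis
      using recip_power_bounds(1)[OF p] corank_prob_self[OF p, of k m] by simp
  next
    case False
    then have "?z < corank_prob p k m c"
      using Cons.prems by (intro corank_prob_gt_zero_matrix[OF p _ nexc]) auto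
    then show ?thesis
      using Cons.prems recip_power_bounds(1)[OF p] chain_prob_ge_min[OF p, of c b m k]
      by (intro mult_less_le_imp_less) auto
  qed
  then show ?case by (simp add: power_add)
qed simp

section \<open>The vectors and their diagonal matrices\<close>

lemma finite_bvecs: "finite (bvecs s m)"
proof (rule finite_subset)
  show "bvecs s m \<subseteq> {b. set b \<subseteq> {..m} \<and> length b = s}" by (auto simp: bvecs_def)
qed (simp add: finite_lists_length_eq)

lemma replicate_in_bvecs:
  assumes "c \<le> m"
  shows "replicate s c \<in> bvecs s m"
  using assms by (simp add: bvecs_def sorted_wrt_iff_nth_less nth_Cons')

lemma diag_all_iff:
  assumes "b \<in> bvecs s m" "m \<le> n"
  shows "(\<forall>j < m. corr_diag_mat p s n m b $$ (j, j) = x) \<longleftrightarrow> (\<forall>y \<in> set (diag_entries p s m b). y = x)"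
  using assms length_diag_entries[OF assms(1), of p]
  by (simp add: corr_diag_mat_def all_set_conv_all_nth)

text \<open>The entries equal to \<open>1\<close> are the \<open>m - b\<^sub>1\<close> copies of \<open>p^0\<close> at the front; the \<open>b\<^sub>1\<close> entries after
  them are higher powers of \<open>p\<close> or \<open>0\<close>. So all entries are \<open>1\<close> exactly if \<open>b\<^sub>1 = 0\<close>.\<close>

lemma full_rank_diag_iff:
  assumes p: "2 \<le> p" and b: "b \<in> bvecs s m" and "m \<le> n" "0 < s"
  shows "full_rank_diag (corr_diag_mat p s n m b) \<longleftrightarrow> b = replicate s 0"
proof -
  obtain c d where bc: "b = c # d" and s: "s = Suc (length d)"
    using b \<open>0 < s\<close> by (cases b) (auto simp: bvecs_def)
  have dec: "c \<le> m" "sorted_wrt (\<ge>) (c # d)" using b by (auto simp: bvecs_def bc)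
  define R where "R = concat (map (\<lambda>i. replicate ((m # b) ! (i - 1) - (m # b) ! i) (int p ^ (i - 1)))
      [2..<s + 1]) @ replicate ((m # b) ! s) 0"
  have split: "diag_entries p s m b = replicate (m - c) 1 @ R"
    unfolding diag_entries_def R_def using \<open>0 < s\<close>
    by (simp add: upt_conv_Cons bc numeral_2_eq_2 del: upt_Suc)
  have R_ne_1: "y \<noteq> 1" if "y \<in> set R" for y
  proof -
    have "1 < int p ^ j" if "0 < j" for j using p that by (intro one_less_power) auto
    then have "int p ^ j \<noteq> 1" if "0 < j" for j using that by (metis less_irrefl)
    then show ?thesis using that by (auto simp: R_def)
  qed
  have len: "length R = c"
    using length_diag_entries[OF b, of p] dec unfolding split by simp
  have "full_rank_diag (corr_diag_mat p s n m b) \<longleftrightarrow> (\<forall>y \<in> set (diag_entries p s m b). y = 1)"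
    using diag_all_iff[OF b \<open>m \<le> n\<close>, of p 1] by (simp add: full_rank_diag_def corr_diag_mat_def)
  also have "\<dots> \<longleftrightarrow> R = []"
    unfolding split using R_ne_1 by (cases R) auto
  also have "\<dots> \<longleftrightarrow> c = 0" using len by auto
  also have "\<dots> \<longleftrightarrow> b = replicate s 0"
    using decreasing_from_0[of d] dec by (auto simp: bc s)
  finally show ?thesis .
qed

text \<open>The zero entries are the last \<open>b\<^sub>s\<close> ones, as the powers of \<open>p\<close> before them are
  nonzero integers. So the matrix vanishes exactly if \<open>b\<^sub>s = m\<close>, which forces all \<open>b\<^sub>i = m\<close>.\<close>

lemma corr_diag_mat_eq_0_iff:
  assumes p: "2 \<le> p" and b: "b \<in> bvecs s m" and "m \<le> n" "0 < s"
  shows "corr_diag_mat p s n m b = 0\<^sub>m n m \<longleftrightarrow> b = replicate s m"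
proof -
  have len: "length b = s" and dec: "sorted_wrt (\<ge>) (m # b)" using b by (auto simp: bvecs_def)
  define z where "z = (m # b) ! s"
  define R where "R = concat (map (\<lambda>i. replicate ((m # b) ! (i - 1) - (m # b) ! i) (int p ^ (i - 1)))
      [1..<s + 1])"
  have split: "diag_entries p s m b = R @ replicate z 0"
    unfolding diag_entries_def R_def z_def ..
  have R_ne_0: "y \<noteq> 0" if "y \<in> set R" for y
    using that p by (auto simp: R_def split: if_splits)
  have lenR: "length R + z = m"
    using length_diag_entries[OF b, of p] unfolding split by simp
  have "corr_diag_mat p s n m b = 0\<^sub>m n m \<longleftrightarrow> (\<forall>y \<in> set (diag_entries p s m b). y = 0)"
  proof -
    have "corr_diag_mat p s n m b = 0\<^sub>m n m \<longleftrightarrow> (\<forall>j < m. corr_diag_mat p s n m b $$ (j, j) = 0)"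
      using \<open>m \<le> n\<close> by (auto simp: corr_diag_mat_def mat_eq_iff)
    then show ?thesis using diag_all_iff[OF b \<open>m \<le> n\<close>, of p 0] by simp
  qed
  also have "\<dots> \<longleftrightarrow> R = []"
    unfolding split using R_ne_0 by (cases R) auto
  also have "\<dots> \<longleftrightarrow> z = m" using lenR by auto
  also have "\<dots> \<longleftrightarrow> b = replicate s m"
  proof
    assume z: "z = m"
    have "b ! i = m" if "i < s" for i
    proof -
      have "b ! i \<le> m" using dec len that by auto
      moreover have "z \<le> b ! i"
      proof (cases "Suc i = s")
        case True
        then show ?thesis by (auto simp: z_def)
      next
        case False
        then show ?thesis
          using sorted_wrt_nth_less[OF dec, of "Suc i" s] that len by (simp add: z_def)
      qed
      ultimately show ?thesis using z by simp
    qed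
    then show "b = replicate s m" using len by (intro nth_equalityI) auto
  qed (use \<open>0 < s\<close> in \<open>simp add: z_def\<close>)
  finally show ?thesis .
qed

section \<open>The extreme values\<close>

lemma Max_image_unique:
  fixes f :: "'a \<Rightarrow> real"
  assumes "finite B" "x \<in> B" "\<And>b. b \<in> B \<Longrightarrow> b \<noteq> x \<Longrightarrow> f b < f x"
  shows "Max (f ` B) = f x" "\<forall>b \<in> B. f b = Max (f ` B) \<longleftrightarrow> b = x"
proof -
  show "Max (f ` B) = f x"
    using assms by (intro Max_eqI) (auto, metis less_eq_real_def)
  then show "\<forall>b \<in> B. f b = Max (f ` B) \<longleftrightarrow> b = x"
    using assms(3) by fastforce
qed

theorem theorem5p1:
  fixes p m n s n' :: nat
  assumes "prime p" and "0 < m" and "m \<le> n" and "0 < s" and "n' = n - m"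
  defines "B \<equiv> bvecs s m"
    and "f \<equiv> snf_density p s m n'"
    and "D \<equiv> corr_diag_mat p s n m"
    and "case_i \<equiv> p > 2 \<or> s > 1 \<or> n' > 0"
    and "case_ii \<equiv> p = 2 \<and> s = 1 \<and> n' = 0 \<and> m > 1"
  shows
    "(case_i \<longrightarrow>
        Max (f ` B) = pbracket p (n' + m) / pbracket p n' \<and>
        replicate s 0 \<in> B \<and>
        (\<forall>b\<in>B. (f b = Max (f ` B) \<longleftrightarrow> b = replicate s 0) \<and>
               (b = replicate s 0 \<longleftrightarrow> full_rank_diag (D b)))) \<and>
     (case_ii \<longrightarrow>
        Max (f ` B) = (pbracket 2 m)\<^sup>2 / (pbracket 2 1 * pbracket 2 (m - 1)) \<and>
        [1] \<in> B \<and>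
        (\<forall>b\<in>B. f b = Max (f ` B) \<longleftrightarrow> b = [1])) \<and>
     (case_i \<or> case_ii \<longrightarrow>
        Min (f ` B) = real p powi (- int (s * (n' + m) * m)) \<and>
        replicate s m \<in> B \<and>
        f (replicate s m) = Min (f ` B) \<and>
        (\<not> (p = 2 \<and> n' = 0 \<and> m = 1) \<longrightarrow>
           (\<forall>b\<in>B. f b = Min (f ` B) \<longleftrightarrow> b = replicate s m)) \<and>
        (\<forall>b\<in>B. b = replicate s m \<longleftrightarrow> D b = 0\<^sub>m n m)) \<and>
     (p = 2 \<and> s = 1 \<and> n' = 0 \<and> m = 1 \<longrightarrow>
        B = {[1], [0]} \<and> f [1] = 1 / 2 \<and> f [0] = 1 / 2)"
proof -
  have p: "2 \<le> p" using assms(1) by (rule prime_ge_2_nat)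
  have fin: "finite B" unfolding B_def by (rule finite_bvecs)
  have len: "length b = s" and dec: "sorted_wrt (\<ge>) (m # b)" if "b \<in> B" for b
    using that by (auto simp: B_def bvecs_def)
  have f_chain: "f b = chain_prob p n' m b" if "b \<in> B" for b
    using snf_density_eq_chain_prob[OF p, of b m n'] len[OF that] by (simp add: f_def)
  have zero: "replicate s 0 \<in> B" and full: "replicate s m \<in> B"
    unfolding B_def by (intro replicate_in_bvecs; simp)+
  have I: "Max (f ` B) = pbracket p (n' + m) / pbracket p n' \<and> replicate s 0 \<in> B \<and>
      (\<forall>b\<in>B. (f b = Max (f ` B) \<longleftrightarrow> b = replicate s 0) \<and> (b = replicate s 0 \<longleftrightarrow> full_rank_diag (D b)))"
    if "case_i"
  proof -
    have v: "f (replicate s 0) = pbracket p (n' + m) / pbracket p n'"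
      using f_chain[OF zero] chain_prob_replicate_0[OF p \<open>0 < s\<close>] by simp
    have "f b < f (replicate s 0)" if "b \<in> B" "b \<noteq> replicate s 0" for b
      unfolding v f_chain[OF that(1)] using that len[OF that(1)] dec[OF that(1)] \<open>case_i\<close>
      by (intro chain_prob_less_max[OF p]) (auto simp: case_i_def)
    note mx = Max_image_unique[where f = f, OF fin zero this]
    have "b = replicate s 0 \<longleftrightarrow> full_rank_diag (D b)" if "b \<in> B" for b
      using full_rank_diag_iff[OF p _ \<open>m \<le> n\<close> \<open>0 < s\<close>, of b] that by (simp add: B_def D_def)
    with mx v zero show ?thesis by simp
  qed
  have II: "Max (f ` B) = (pbracket 2 m)\<^sup>2 / (pbracket 2 1 * pbracket 2 (m - 1)) \<and> [1] \<in> B \<and>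
      (\<forall>b\<in>B. f b = Max (f ` B) \<longleftrightarrow> b = [1])" if "case_ii"
  proof -
    have eq: "p = 2" "s = 1" "n' = 0" "2 \<le> m" using that by (auto simp: case_ii_def)
    have one: "[1] \<in> B" using replicate_in_bvecs[of 1 m s] eq by (simp add: B_def)
    have v: "f [1] = (pbracket 2 m)\<^sup>2 / (pbracket 2 1 * pbracket 2 (m - 1))"
      using f_chain[OF one] eq by (simp add: corank_prob_def pbracket_Suc power2_eq_square)
    have "f b < f [1]" if b: "b \<in> B" "b \<noteq> [1]" for b
    proof -
      obtain c where "b = [c]" using len[OF b(1)] eq by (cases b) auto
      then show ?thesis
        using corank_prob_square_2_max[of m c] b dec[OF b(1)] eq f_chain[OF b(1)] f_chain[OF one]
        by simp
    qed
    note mx = Max_image_unique[where f = f, OF fin one this]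
    with v one show ?thesis by simp
  qed
  have III: "Min (f ` B) = real p powi (- int (s * (n' + m) * m)) \<and> replicate s m \<in> B \<and>
      f (replicate s m) = Min (f ` B) \<and>
      (\<not> (p = 2 \<and> n' = 0 \<and> m = 1) \<longrightarrow> (\<forall>b\<in>B. f b = Min (f ` B) \<longleftrightarrow> b = replicate s m)) \<and>
      (\<forall>b\<in>B. b = replicate s m \<longleftrightarrow> D b = 0\<^sub>m n m)"
  proof -
    have v: "f (replicate s m) = (1 / real p) ^ (s * ((n' + m) * m))"
      using f_chain[OF full] chain_prob_replicate_self[OF p] by simp
    have le: "f (replicate s m) \<le> f b" if "b \<in> B" for b
      using chain_prob_ge_min[OF p dec[OF that], of m n'] len[OF that] f_chain[OF that] v by simp
    have mn: "Min (f ` B) = f (replicate s m)"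
      using fin full le by (intro Min_eqI) auto
    have less: "f (replicate s m) < f b"
      if "b \<in> B" "b \<noteq> replicate s m" "\<not> (p = 2 \<and> n' = 0 \<and> m = 1)" for b
      using chain_prob_gt_min[OF p dec[OF that(1)], of n'] that len[OF that(1)] f_chain[OF that(1)] v
      by simp
    have "b = replicate s m \<longleftrightarrow> D b = 0\<^sub>m n m" if "b \<in> B" for b
      using corr_diag_mat_eq_0_iff[OF p _ \<open>m \<le> n\<close> \<open>0 < s\<close>, of b] that by (simp add: B_def D_def)
    moreover have "f b = Min (f ` B) \<longleftrightarrow> b = replicate s m"
      if "b \<in> B" "\<not> (p = 2 \<and> n' = 0 \<and> m = 1)" for b
      using less[OF that(1) _ that(2)] mn by force
    moreover have "Min (f ` B) = real p powi (- int (s * (n' + m) * m))"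
      unfolding mn v powi_neg_eq by (simp add: mult.assoc)
    ultimately show ?thesis using full mn by simp
  qed
  have IV: "B = {[1], [0]} \<and> f [1] = 1 / 2 \<and> f [0] = 1 / 2"
    if eq: "p = 2" "s = 1" "n' = 0" "m = 1"
  proof -
    have B: "B = {[1], [0]}"
    proof
      show "B \<subseteq> {[1], [0]}"
      proof
        fix b assume b: "b \<in> B"
        then obtain c where "b = [c]" using len[OF b] eq by (cases b) auto
        then show "b \<in> {[1], [0]}" using dec[OF b] eq by auto
      qed
      show "{[1], [0]} \<subseteq> B" using zero full eq by simp
    qed
    then show ?thesis
      using f_chain[of "[1]"] f_chain[of "[0]"] eq
      by (simp add: corank_prob_def pbracket_Suc)
  qed
  show ?thesis using I II III IV by blast
qed

end
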